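(* Let $L$ be a bounded lattice with enough prime elements. Then $L$ satisfies the join-infinite distributive law: for every $x\in L$ and every $A\subseteq L$ whose supremum $\bigvee A$ exists in $L$, the supremum of $\{x\wedge a:a\in A\}$ exists in $L$ and $$x\wedge\bigvee A=\bigvee_{a\in A}(x\wedge a).$$
   Context: An element $r$ of a lattice is \emph{prime} if it is not a greatest element and, for all $a,b$, $a\wedge b\le r$ implies $a\le r$ or $b\le r$. A lattice has \emph{enough prime elements} if, whenever $a\nleq b$, there is a prime element $r\ge b$ with $a\nleq r$. *)

theory Defs
  imports "HOL-Library.Lub_Glb"
begin

definition prime_element :: "'a::lattice \<Rightarrow> bool" where
  "prime_element r \<longleftrightarrow>
     \<not> (\<forall>a. a \<le> r) \<and> (\<forall>a b. inf a b \<le> r \<longrightarrow> a \<le> r \<or> b \<le> r)"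

text \<open>The lattice is the type itself, hence the \<open>itself\<close> argument.\<close>

definition enough_prime_elements :: "'a::lattice itself \<Rightarrow> bool" where
  "enough_prime_elements _ \<longleftrightarrow>
     (\<forall>a b :: 'a. \<not> a \<le> b \<longrightarrow> (\<exists>r. prime_element r \<and> b \<le> r \<and> \<not> a \<le> r))"

text \<open>
  \<open>isLub UNIV A s\<close> (the library's notion) says that the supremum of \<open>A\<close> exists in the whole
  lattice and equals \<open>s\<close>, suprema being unique in an order. The definition below therefore
  states both the existence of the supremum of the meets and the distributive equation.
\<close>

definition join_infinite_distributive :: "'a::lattice itself \<Rightarrow> bool" where
  "join_infinite_distributive _ \<longleftrightarrow>
     (\<forall>(x :: 'a) A s. isLub UNIV A s \<longrightarrow> isLub UNIV {inf x a | a. a \<in> A} (inf x s))"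

end

theory Submission
  imports Defs
begin

text \<open>
  The element \<open>inf x s\<close> clearly bounds all \<open>inf x a\<close> from above. That it lies below every other
  upper bound \<open>u\<close> is tested on primes: if it did not, some prime \<open>r\<close> above \<open>u\<close> would not be
  above \<open>inf x s\<close>, hence not above \<open>x\<close>. Primality of \<open>r\<close> then cancels \<open>x\<close> from each
  \<open>inf x a \<le> r\<close>, which makes \<open>r\<close> an upper bound of \<open>A\<close> and so forces \<open>inf x s \<le> s \<le> r\<close>.
\<close>

theorem mainTheorem1:
  assumes "enough_prime_elements TYPE('a::bounded_lattice)"
  shows "join_infinite_distributive TYPE('a)"
  unfolding join_infinite_distributive_def
proof (intro allI impI)
  fix x s :: 'a and A :: "'a set"
  assume s: "isLub UNIV A s"
  have upper: "a \<le> s" if "a \<in> A" for a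
    using s that by (rule isLubD2)
  have least: "s \<le> u" if "\<And>a. a \<in> A \<Longrightarrow> a \<le> u" for u
    using s by (rule isLub_le_isUb) (blast intro: isUb_UNIV_I that)
  show "isLub UNIV {inf x a | a. a \<in> A} (inf x s)"
  proof (rule isLubI2)
    show "isUb UNIV {inf x a | a. a \<in> A} (inf x s)"
      by (rule isUb_UNIV_I) (blast intro: inf_mono order_refl upper)
    show "inf x s <=* Collect (isUb UNIV {inf x a | a. a \<in> A})"
    proof (rule setgeI, rule ballI, rule ccontr)
      fix u
      assume "u \<in> Collect (isUb UNIV {inf x a | a. a \<in> A})"
      then have u: "inf x a \<le> u" if "a \<in> A" for a
        using that by (blast intro: isUbD)
      assume "\<not> inf x s \<le> u"
      then obtain r where r: "prime_element r" "u \<le> r" "\<not> inf x s \<le> r"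
        using assms unfolding enough_prime_elements_def by blast
      have "\<not> x \<le> r"
        using r(3) by (auto intro: le_infI1)
      then have "a \<le> r" if "a \<in> A" for a
        using order_trans[OF u[OF that] r(2)] r(1) unfolding prime_element_def by blast
      then have "s \<le> r"
        by (rule least)
      then show False
        using r(3) by (auto intro: le_infI2)
    qed
  qed
qed

end
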